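(* Let $G$ be a finite abelian group with Davenport constant $D(G)$. For every strongly base orderable matroid $M$, every $G$-labeling of $M$ is strongly $(D(G)-1)$-close.
   Context: Matroids are finite and loopless. A matroid is strongly base orderable if for any two bases $A,B$ there is a bijection $f:A\to B$ such that $(A\setminus X)\cup f(X)$ is a base for every $X\subseteq A$. The Davenport constant $D(G)$ is the least integer $d$ such that every sequence of $d$ elements of $G$ has a nonempty subsequence summing to $0$. A $G$-labeling of $M=(E,\mathcal{I})$ is a map $\ell:E\to G$, $\ell(F)=\sum_{e\in F}\ell(e)$; a $g$-base is a base $B$ with $\ell(B)=g$. For $w:E\to\mathbb{R}$, an optimum base is a base of minimum weight $w(B)=\sum_{e\in B}w(e)$, and an optimum $g$-base is a $g$-base of minimum weight among $g$-bases. A $G$-labeling is strongly $k$-close if for every $w:E\to\mathbb{R}$ and every $g\in G$ for which a $g$-base exists, every optimum base $A$ has an optimum $g$-base $B$ with $|A\setminus B|\le k$. *)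

theory Defs
  imports Complex_Main "HOL-Library.Sublist"
begin

locale matroid =
  fixes E :: "'a set" and \<I> :: "'a set set"
  assumes finite_ground: "finite E"
    and indep_subset_ground: "X \<in> \<I> \<Longrightarrow> X \<subseteq> E"
    and indep_empty: "{} \<in> \<I>"
    and indep_subset: "X \<in> \<I> \<Longrightarrow> Y \<subseteq> X \<Longrightarrow> Y \<in> \<I>"
    and augmentation:
      "X \<in> \<I> \<Longrightarrow> Y \<in> \<I> \<Longrightarrow> card X < card Y \<Longrightarrow> \<exists>y \<in> Y - X. insert y X \<in> \<I>"

locale loopless_matroid = matroid +
  assumes loopless: "e \<in> E \<Longrightarrow> {e} \<in> \<I>"

definition is_base :: "'a set set \<Rightarrow> 'a set \<Rightarrow> bool" where
  "is_base \<I> B \<longleftrightarrow> B \<in> \<I> \<and> (\<forall>X \<in> \<I>. B \<subseteq> X \<longrightarrow> X = B)"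

definition strongly_base_orderable :: "'a set set \<Rightarrow> bool" where
  "strongly_base_orderable \<I> \<longleftrightarrow>
    (\<forall>A B. is_base \<I> A \<longrightarrow> is_base \<I> B \<longrightarrow>
      (\<exists>f. bij_betw f A B \<and> (\<forall>X \<subseteq> A. is_base \<I> ((A - X) \<union> f ` X))))"

definition davenport :: "'g::{finite,ab_group_add} itself \<Rightarrow> nat" where
  "davenport _ = (LEAST d. \<forall>xs :: 'g list. length xs = d \<longrightarrow>
    (\<exists>ys. subseq ys xs \<and> ys \<noteq> [] \<and> sum_list ys = 0))"

text \<open>
  Labelings and weight functions are total on the element type; only their values on
  the ground set matter below, since every base is a subset of it.
\<close>

definition is_gbase ::
    "'a set set \<Rightarrow> ('a \<Rightarrow> 'g::ab_group_add) \<Rightarrow> 'g \<Rightarrow> 'a set \<Rightarrow> bool" where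
  "is_gbase \<I> l g B \<longleftrightarrow> is_base \<I> B \<and> sum l B = g"

definition optimum_base :: "'a set set \<Rightarrow> ('a \<Rightarrow> real) \<Rightarrow> 'a set \<Rightarrow> bool" where
  "optimum_base \<I> w = is_arg_min (sum w) (is_base \<I>)"

definition optimum_gbase ::
    "'a set set \<Rightarrow> ('a \<Rightarrow> 'g::ab_group_add) \<Rightarrow> ('a \<Rightarrow> real) \<Rightarrow> 'g \<Rightarrow> 'a set \<Rightarrow> bool" where
  "optimum_gbase \<I> l w g = is_arg_min (sum w) (is_gbase \<I> l g)"

definition strongly_close ::
    "'a set set \<Rightarrow> ('a \<Rightarrow> 'g::ab_group_add) \<Rightarrow> nat \<Rightarrow> bool" where
  "strongly_close \<I> l k \<longleftrightarrow>
    (\<forall>(w :: 'a \<Rightarrow> real) g. (\<exists>B. is_gbase \<I> l g B) \<longrightarrow>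
      (\<forall>A. optimum_base \<I> w A \<longrightarrow> (\<exists>B. optimum_gbase \<I> l w g B \<and> card (A - B) \<le> k)))"

end

theory Submission
  imports Defs
begin

text \<open>
  Among the optimum \<open>g\<close>-bases pick a \<open>B\<close> minimizing \<open>|A - B|\<close>, and let \<open>f : A \<rightarrow> B\<close> be the exchange
  bijection; it fixes \<open>A \<inter> B\<close> pointwise. If \<open>|A - B| \<ge> D(G)\<close>, then the differences \<open>l (f a) - l a\<close>
  for \<open>a \<in> A - B\<close> have a nonempty zero-sum subfamily \<open>Y\<close>. Exchanging \<open>Y\<close> and \<open>f Y\<close> in \<open>B\<close> keeps the
  label, so \<open>w Y \<ge> w (f Y)\<close>, while exchanging them in \<open>A\<close> gives \<open>w (f Y) \<ge> w Y\<close>. Hence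
  \<open>B - f Y \<union> Y\<close> is an optimum \<open>g\<close>-base closer to \<open>A\<close>, a contradiction.
\<close>

text \<open>Two of the \<open>|G| + 1\<close> prefix sums coincide.\<close>

lemma zero_sum_subseq_exists:
  fixes xs :: "'g::{finite,ab_group_add} list"
  assumes "length xs = card (UNIV :: 'g set)"
  shows "\<exists>ys. subseq ys xs \<and> ys \<noteq> [] \<and> sum_list ys = 0"
proof -
  let ?s = "\<lambda>i. sum_list (take i xs)"
  have "\<not> inj_on ?s {..length xs}"
  proof
    assume "inj_on ?s {..length xs}"
    then have "card {..length xs} \<le> card (UNIV :: 'g set)"
      by (rule card_inj_on_le) auto
    then show False using assms by simp
  qed
  then obtain i j where ij: "i \<le> length xs" "j \<le> length xs" "i < j" "?s i = ?s j"
    unfolding inj_on_def by (metis atMost_iff linorder_neqE_nat)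
  let ?ys = "drop i (take j xs)"
  have "take j xs = take i xs @ ?ys"
    using ij(3) by (metis append_take_drop_id less_imp_le_nat min.absorb1 take_take)
  then have "?s j = ?s i + sum_list ?ys"
    by (metis sum_list_append)
  then have "sum_list ?ys = 0" using ij(4) by simp
  moreover have "?ys \<noteq> []" using ij by simp
  moreover have "subseq ?ys xs"
    by (meson prefix_imp_subseq subseq_order.trans suffix_drop suffix_imp_subseq take_is_prefix)
  ultimately show ?thesis by blast
qed

text \<open>The order of \<open>'g\<close> witnesses that the \<open>LEAST\<close> in
  \<open>davenport\<close> is attained. Longer lists reduce to their prefix of length
  \<open>davenport TYPE('g)\<close>.\<close>

lemma davenport_zero_sum_subseq:
  fixes xs :: "'g::{finite,ab_group_add} list"
  assumes "davenport TYPE('g) \<le> length xs"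
  shows "\<exists>ys. subseq ys xs \<and> ys \<noteq> [] \<and> sum_list ys = 0"
proof -
  let ?P = "\<lambda>d. \<forall>xs :: 'g list. length xs = d \<longrightarrow>
    (\<exists>ys. subseq ys xs \<and> ys \<noteq> [] \<and> sum_list ys = 0)"
  have "?P (card (UNIV :: 'g set))" using zero_sum_subseq_exists by blast
  then have "?P (davenport TYPE('g))"
    unfolding davenport_def by (rule LeastI)
  moreover have "length (take (davenport TYPE('g)) xs) = davenport TYPE('g)"
    using assms by simp
  ultimately obtain ys where "subseq ys (take (davenport TYPE('g)) xs)" "ys \<noteq> []" "sum_list ys = 0"
    by blast
  then show ?thesis
    by (meson prefix_imp_subseq subseq_order.trans take_is_prefix)
qed

lemma davenport_zero_sum_subset:
  fixes h :: "'a \<Rightarrow> 'g::{finite,ab_group_add}"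
  assumes "finite S" and "davenport TYPE('g) \<le> card S"
  shows "\<exists>Y \<subseteq> S. Y \<noteq> {} \<and> sum h Y = 0"
proof -
  obtain xs where xs: "set xs = S" "distinct xs"
    using finite_distinct_list[OF assms(1)] by blast
  then have "davenport TYPE('g) \<le> length (map h xs)"
    using assms(2) distinct_card by fastforce
  from davenport_zero_sum_subseq[OF this]
  obtain ys where ys: "subseq ys (map h xs)" "ys \<noteq> []" "sum_list ys = 0" by blast
  \<comment> \<open>Since \<open>h\<close> may repeat values, \<open>ys\<close> alone does not
    determine a subset of \<open>S\<close>; the positions \<open>N\<close> do, because
    \<open>xs\<close> is distinct.\<close>
  obtain N where "ys = nths (map h xs) N"
    using ys(1) by (auto simp: subseq_conv_nths)
  then have N: "ys = map h (nths xs N)" by (simp add: nths_map)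
  have "sum h (set (nths xs N)) = 0"
    using ys(3) N xs(2) by (simp add: sum_list_distinct_conv_sum_set)
  moreover have "set (nths xs N) \<subseteq> S" using xs(1) by (auto dest: in_set_nthsD)
  moreover have "set (nths xs N) \<noteq> {}" using ys(2) N by auto
  ultimately show ?thesis by blast
qed

lemma sum_exchange:
  fixes h :: "'a \<Rightarrow> 'g::ab_group_add"
  assumes "finite B" "finite Y" "Z \<subseteq> B" "Y \<inter> B = {}"
  shows "sum h ((B - Z) \<union> Y) = sum h B - sum h Z + sum h Y"
  using assms by (subst sum.union_disjoint) (auto simp: sum_diff)

context matroid
begin

lemma base_subset_ground: "is_base \<I> B \<Longrightarrow> B \<subseteq> E"
  by (simp add: is_base_def indep_subset_ground)

lemma finite_base: "is_base \<I> B \<Longrightarrow> finite B"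
  using base_subset_ground finite_ground finite_subset by blast

lemma finite_bases: "finite {B. is_base \<I> B}"
  by (rule finite_subset[of _ "Pow E"]) (auto simp: finite_ground dest: base_subset_ground)

end

text \<open>If the preimage \<open>a\<close> of \<open>x\<close> were not \<open>x\<close>,
  exchanging \<open>a\<close> alone would yield \<open>A - {a}\<close>, a proper subset of the base
  \<open>A\<close> and hence no base.\<close>

lemma exchange_bijection_fixes_inter:
  assumes "is_base \<I> A"
    and f: "bij_betw f A B" and ex: "\<And>X. X \<subseteq> A \<Longrightarrow> is_base \<I> ((A - X) \<union> f ` X)"
    and x: "x \<in> A" "x \<in> B"
  shows "f x = x"
proof -
  obtain a where a: "a \<in> A" "f a = x" using f x(2) by (auto simp: bij_betw_def)
  have "a = x"
  proof (rule ccontr)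
    assume "a \<noteq> x"
    then have "(A - {a}) \<union> f ` {a} = A - {a}" using a x by auto
    then have "is_base \<I> (A - {a})" using ex[of "{a}"] a by simp
    then show False using assms(1) a(1) unfolding is_base_def by blast
  qed
  then show ?thesis using a by simp
qed

theorem theorem5:
  fixes E :: "'a set" and \<I> :: "'a set set"
    and l :: "'a \<Rightarrow> 'g::{finite,ab_group_add}"
  assumes "loopless_matroid E \<I>"
    and "strongly_base_orderable \<I>"
  shows "strongly_close \<I> l (davenport TYPE('g) - 1)"
proof -
  interpret loopless_matroid E \<I> by (rule assms(1))
  have "\<exists>B. optimum_gbase \<I> l w g B \<and> card (A - B) \<le> davenport TYPE('g) - 1"
    if gb: "\<exists>B. is_gbase \<I> l g B" and A: "optimum_base \<I> w A" for w :: "'a \<Rightarrow> real" and g A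
  proof -
    have "finite {B. is_gbase \<I> l g B}"
      by (rule finite_subset[OF _ finite_bases]) (auto simp: is_gbase_def)
    then have "\<exists>B. optimum_gbase \<I> l w g B"
      using ex_is_arg_min_if_finite[of "{B. is_gbase \<I> l g B}" "sum w"] gb
      by (auto simp: optimum_gbase_def)
    then obtain B where B: "optimum_gbase \<I> l w g B"
      and least: "\<And>B'. optimum_gbase \<I> l w g B' \<Longrightarrow> card (A - B) \<le> card (A - B')"
      using ex_has_least_nat[of "optimum_gbase \<I> l w g" _ "\<lambda>B. card (A - B)"] by blast
    have bA: "is_base \<I> A" and minA: "\<And>C. is_base \<I> C \<Longrightarrow> sum w A \<le> sum w C"
      using A by (auto simp: optimum_base_def is_arg_min_linorder)
    have bB: "is_base \<I> B" and lB: "sum l B = g"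
      and minB: "\<And>C. is_gbase \<I> l g C \<Longrightarrow> sum w B \<le> sum w C"
      using B by (auto simp: optimum_gbase_def is_arg_min_linorder is_gbase_def)
    have fin: "finite A" "finite B" using bA bB finite_base by auto
    obtain f where f: "bij_betw f A B"
      and ex: "\<And>X. X \<subseteq> A \<Longrightarrow> is_base \<I> ((A - X) \<union> f ` X)"
      using assms(2) bA bB unfolding strongly_base_orderable_def by blast
    have fixed: "f x = x" if "x \<in> A" "x \<in> B" for x
      using exchange_bijection_fixes_inter[OF bA f ex that] .
    have inj: "inj_on f A" and fA: "f ` A = B" using f by (auto simp: bij_betw_def)
    have "card (A - B) \<le> davenport TYPE('g) - 1"
    proof (rule ccontr)
      assume "\<not> ?thesis"
      then have "davenport TYPE('g) \<le> card (A - B)" by simp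
      from davenport_zero_sum_subset[OF _ this, of "\<lambda>a. l (f a) - l a"] fin
      obtain Y where Y: "Y \<subseteq> A - B" "Y \<noteq> {}" "(\<Sum>a\<in>Y. l (f a) - l a) = 0" by auto
      have YA: "Y \<subseteq> A" and YB: "Y \<inter> B = {}" using Y(1) by auto
      have fY: "f ` Y \<subseteq> B" using YA fA by auto
      \<comment> \<open>If \<open>f y\<close> were in \<open>A\<close>, it would lie in both bases
        and be fixed by \<open>f\<close>. Injectivity would give \<open>f y = y\<close>, putting
        \<open>y\<close> in \<open>B\<close>.\<close>
      have fYA: "f ` Y \<inter> A = {}"
      proof -
        have False if "y \<in> Y" "f y \<in> A" for y
        proof -
          have "f (f y) = f y" using fixed that fY by blast
          then have "f y = y" using inj that YA by (auto dest: inj_onD)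
          then show False using that fY YB by fastforce
        qed
        then show ?thesis by blast
      qed
      have finY: "finite Y" using YA fin finite_subset by blast
      have injY: "inj_on f Y" using inj YA inj_on_subset by blast
      have lY: "sum l (f ` Y) = sum l Y"
        using Y(3) by (simp add: sum_subtractf sum.reindex[OF injY])
      let ?A = "(A - Y) \<union> f ` Y" and ?B = "(B - f ` Y) \<union> Y"
      \<comment> \<open>Exchanging \<open>Y\<close> back in \<open>B\<close> is exchanging the
        complement \<open>A - Y\<close> in \<open>A\<close>, because \<open>f\<close> maps
        \<open>A\<close> onto \<open>B\<close>.\<close>
      have "?B = (A - (A - Y)) \<union> f ` (A - Y)"
        using inj_on_image_set_diff[OF inj, of A Y] YA fA by auto
      then have bB': "is_base \<I> ?B" using ex[of "A - Y"] by simp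
      note sumB = sum_exchange[OF fin(2) finY fY YB]
      have sumA: "sum w ?A = sum w A - sum w Y + sum w (f ` Y)"
        using sum_exchange[OF fin(1) _ YA fYA] finY by simp
      have gB': "is_gbase \<I> l g ?B"
        using bB' lB sumB[of l] lY by (simp add: is_gbase_def)
      \<comment> \<open>Optimality of \<open>A\<close> against \<open>?A\<close> gives w(Y) \<le>
        w(f Y). A \<open>g\<close>-base no heavier than the optimum \<open>B\<close> is itself
        optimum.\<close>
      have "sum w ?B \<le> sum w B"
        using minA[OF ex[OF YA]] sumA sumB[of w] by simp
      then have "optimum_gbase \<I> l w g ?B"
        using gB' minB by (fastforce simp: optimum_gbase_def is_arg_min_linorder)
      then have "card (A - B) \<le> card (A - ?B)" by (rule least)
      moreover have "A - ?B \<subset> A - B" using Y(1,2) fYA by blast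
      then have "card (A - ?B) < card (A - B)" using fin by (simp add: psubset_card_mono)
      ultimately show False by simp
    qed
    with B show ?thesis by blast
  qed
  then show ?thesis unfolding strongly_close_def by blast
qed

end
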